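(* Let $X_d\subseteq\mathbf{P}(a_0,\dots,a_5)$, with $a_0\le\dots\le a_5$, be an FK3 weighted fourfold such that $\dim X_d^{\mathrm{sing}}\le 1$. If $a_5>1$, then there exists an index $i\in\{0,\dots,4\}$ such that $a_i+a_5=d$.
   Context: We work over $\mathbf{C}$. $\mathbf{P}(a_0,\dots,a_n)=\mathrm{Proj}\,\mathbf{C}[x_0,\dots,x_n]$ with $\deg x_i=a_i\in\mathbf{Z}_{>0}$, and $X_d=V(f_d)$ with $f_d$ weighted homogeneous of degree $d$. A weighted hypersurface $X_d$ is always assumed to be: quasi-smooth (the punctured affine cone $\{f_d=0\}\subseteq\mathbf{A}^{n+1}\setminus\{0\}$ is smooth); not a linear cone ($d\ne a_i$ for all $i$); well-formed (the gcd of any $n$ of the $n+1$ weights is $1$, and the gcd of any $n-1$ of the weights divides $d$). FK3 weighted fourfold: a weighted hypersurface $X_d\subseteq\mathbf{P}(a_0,\dots,a_5)$ with $\sum_{i=0}^5a_i=2d$. This is the numerical form of the requirement that $X_d$ is Fano and $H^4(X_d,\mathbf{C})$ is of K3 type ($h^{1,3}=1$ and $\max\{q-p: H^{p,q}\neq 0\}=2$). The condition $\dim X_d^{\mathrm{sing}}\le 1$ means numerically: the gcd of any four of the weights is $1$ and the gcd of any three of the weights divides $d$. Numerical form of quasi-smoothness and not being a linear cone for a general $X_d$: $a_i\neq d$ for all $i$, and for each nonempty $I\subseteq\{0,\dots,n\}$ either $d=\sum_{i\in I}n_ia_i$ for some $n_i\in\mathbf{Z}_{\ge0}$, or there are at least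 $|I|$ indices $j\notin I$ such that $d-a_j=\sum_{i\in I}n_ia_i$ for some $n_i\in\mathbf{Z}_{\ge0}$ (depending on $j$). *)

theory Defs
  imports "HOL-Analysis.Analysis" "HOL-Library.Poly_Mapping"
begin

text \<open>
  A polynomial in \<open>\<complex>[x\<^sub>0, x\<^sub>1, \<dots>]\<close> is a finitely supported map from monomials
  (finitely supported exponent vectors) to coefficients; membership in \<open>\<complex>[x\<^sub>0, \<dots>, x\<^sub>n]\<close> is the
  condition \<open>vars_upto n\<close>.
\<close>

type_synonym mpoly_complex = "(nat \<Rightarrow>\<^sub>0 nat) \<Rightarrow>\<^sub>0 complex"

definition vars_upto :: "nat \<Rightarrow> mpoly_complex \<Rightarrow> bool" where
  "vars_upto n f \<longleftrightarrow> (\<forall>m \<in> Poly_Mapping.keys f. Poly_Mapping.keys m \<subseteq> {..n})"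

definition mpoly_eval :: "mpoly_complex \<Rightarrow> (nat \<Rightarrow> complex) \<Rightarrow> complex" where
  "mpoly_eval f x =
     (\<Sum>m \<in> Poly_Mapping.keys f. Poly_Mapping.lookup f m *
        (\<Prod>i \<in> Poly_Mapping.keys m. x i ^ Poly_Mapping.lookup m i))"

definition mpoly_partial :: "mpoly_complex \<Rightarrow> nat \<Rightarrow> (nat \<Rightarrow> complex) \<Rightarrow> complex" where
  "mpoly_partial f i x = deriv (\<lambda>t. mpoly_eval f (x(i := t))) (x i)"

definition weighted_homogeneous :: "nat \<Rightarrow> (nat \<Rightarrow> nat) \<Rightarrow> nat \<Rightarrow> mpoly_complex \<Rightarrow> bool" where
  "weighted_homogeneous n a d f \<longleftrightarrow>
     (\<forall>m \<in> Poly_Mapping.keys f. (\<Sum>i\<le>n. a i * Poly_Mapping.lookup m i) = d)"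

text \<open>
  Smoothness of the punctured affine cone \<open>{f = 0} \<subseteq> \<complex>\<^sup>n\<^sup>+\<^sup>1 - {0}\<close>, by the Jacobian criterion.
  Points are functions on \<open>nat\<close>, of which only the coordinates \<open>0, \<dots>, n\<close> matter when
  \<open>vars_upto n f\<close> holds.
\<close>

definition quasi_smooth :: "nat \<Rightarrow> mpoly_complex \<Rightarrow> bool" where
  "quasi_smooth n f \<longleftrightarrow>
     (\<forall>x. (\<exists>i\<le>n. x i \<noteq> 0) \<longrightarrow> mpoly_eval f x = 0 \<longrightarrow> (\<exists>i\<le>n. mpoly_partial f i x \<noteq> 0))"

definition linear_cone :: "nat \<Rightarrow> (nat \<Rightarrow> nat) \<Rightarrow> nat \<Rightarrow> bool" where
  "linear_cone n a d \<longleftrightarrow> (\<exists>i\<le>n. d = a i)"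

definition well_formed :: "nat \<Rightarrow> (nat \<Rightarrow> nat) \<Rightarrow> nat \<Rightarrow> bool" where
  "well_formed n a d \<longleftrightarrow>
     (\<forall>I \<subseteq> {..n}. card I = n \<longrightarrow> Gcd (a ` I) = 1) \<and>
     (\<forall>I \<subseteq> {..n}. card I = n - 1 \<longrightarrow> Gcd (a ` I) dvd d)"

text \<open>The hypersurface \<open>X\<^sub>d = V(f) \<subseteq> P(a\<^sub>0, \<dots>, a\<^sub>n)\<close> with its standing assumptions.\<close>

definition weighted_hypersurface ::
    "nat \<Rightarrow> (nat \<Rightarrow> nat) \<Rightarrow> nat \<Rightarrow> mpoly_complex \<Rightarrow> bool" where
  "weighted_hypersurface n a d f \<longleftrightarrow>
     (\<forall>i\<le>n. a i > 0) \<and> f \<noteq> 0 \<and> vars_upto n f \<and> weighted_homogeneous n a d f \<and>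
     quasi_smooth n f \<and> \<not> linear_cone n a d \<and> well_formed n a d"

text \<open>
  The condition on the weights is the numerical form of: \<open>X\<^sub>d\<close> is Fano and its fourth cohomology
  is of K3 type.
\<close>

definition FK3_weighted_fourfold :: "(nat \<Rightarrow> nat) \<Rightarrow> nat \<Rightarrow> mpoly_complex \<Rightarrow> bool" where
  "FK3_weighted_fourfold a d f \<longleftrightarrow>
     weighted_hypersurface 5 a d f \<and> (\<Sum>i\<le>5. a i) = 2 * d"

text \<open>
  The numerical meaning of \<open>dim X\<^sub>d\<^sup>s\<^sup>i\<^sup>n\<^sup>g \<le> 1\<close> for a fourfold \<open>X\<^sub>d \<subseteq> P(a\<^sub>0, \<dots>, a\<^sub>5)\<close>.
  The singular locus of a well-formed quasi-smooth hypersurface is its intersection with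
  the coordinate strata whose weights have a common factor, so the condition excludes
  such strata of dimension 3 and those of dimension 2 that lie in \<open>X\<^sub>d\<close>.
\<close>

definition dim_sing_le_1 :: "(nat \<Rightarrow> nat) \<Rightarrow> nat \<Rightarrow> bool" where
  "dim_sing_le_1 a d \<longleftrightarrow>
     (\<forall>I \<subseteq> {..5}. card I = 4 \<longrightarrow> Gcd (a ` I) = 1) \<and>
     (\<forall>I \<subseteq> {..5}. card I = 3 \<longrightarrow> Gcd (a ` I) dvd d)"

end

theory Submission
  imports Defs "HOL-Computational_Algebra.Fundamental_Theorem_Algebra"
begin

text \<open>
  Restricting \<open>f\<close> and its partial derivatives to a coordinate axis or a coordinate plane turns
  quasi-smoothness into the statement that \<open>d\<close> or enough of the \<open>d - a\<^sub>j\<close> are combinations of the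
  corresponding one or two weights; on a plane, a single nonzero transversal derivative would
  vanish somewhere by the fundamental theorem of algebra.

  Let no \<open>a\<^sub>i + a\<^sub>5\<close> equal \<open>d\<close>. Since \<open>2 d\<close> is the sum of the weights, the axis of \<open>x\<^sub>5\<close> gives
  \<open>d = 2 a\<^sub>5\<close> or \<open>d = 2 a\<^sub>5 + a\<^sub>0\<close>. The plane of \<open>x\<^sub>4, x\<^sub>5\<close> reduces the second case to
  \<open>a\<^sub>2 = a\<^sub>3 = a\<^sub>4 = a\<^sub>5\<close>, against the gcd condition. In the first case put \<open>b = a\<^sub>5\<close>, \<open>e = b - a\<^sub>4\<close>
  and \<open>e' = b - a\<^sub>3\<close>. The axes of \<open>x\<^sub>2, x\<^sub>3, x\<^sub>4\<close> and the planes of \<open>x\<^sub>2, x\<^sub>3\<close> and \<open>x\<^sub>3, x\<^sub>4\<close> leave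
  only the weights \<open>2e, 2e', b - e - e', b - e', b - e, b\<close> in degree \<open>2b\<close>, up to cases with three
  even weights. As no four weights are even and their sum is even, at most two of them are even.
  Hence \<open>b\<close> is odd and \<open>e, e'\<close> are even, and the axis of the variable of weight \<open>2e\<close> contradicts
  \<open>2b \<equiv> 2\<close> modulo \<open>4\<close>.
\<close>

section \<open>Quasi-smoothness along coordinate axes and planes\<close>

lemma mpoly_eval_fun_upd:
  "mpoly_eval f (x(j := t)) =
     (\<Sum>m \<in> Poly_Mapping.keys f. Poly_Mapping.lookup f m * t ^ Poly_Mapping.lookup m j *
        (\<Prod>i \<in> Poly_Mapping.keys m - {j}. x i ^ Poly_Mapping.lookup m i))"
  unfolding mpoly_eval_def
proof (rule sum.cong)
  fix m
  have "(\<Prod>i\<in>Poly_Mapping.keys m. (x(j := t)) i ^ Poly_Mapping.lookup m i) =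
    (\<Prod>i\<in>insert j (Poly_Mapping.keys m). (x(j := t)) i ^ Poly_Mapping.lookup m i)"
    by (rule prod.mono_neutral_left) (auto simp: in_keys_iff)
  also have "\<dots> = t ^ Poly_Mapping.lookup m j *
      (\<Prod>i\<in>Poly_Mapping.keys m - {j}. (x(j := t)) i ^ Poly_Mapping.lookup m i)"
    by (simp add: prod.insert_remove)
  also have "(\<Prod>i\<in>Poly_Mapping.keys m - {j}. (x(j := t)) i ^ Poly_Mapping.lookup m i) =
      (\<Prod>i\<in>Poly_Mapping.keys m - {j}. x i ^ Poly_Mapping.lookup m i)"
    by (rule prod.cong) auto
  finally show "Poly_Mapping.lookup f m *
      (\<Prod>i\<in>Poly_Mapping.keys m. (x(j := t)) i ^ Poly_Mapping.lookup m i) =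
    Poly_Mapping.lookup f m * t ^ Poly_Mapping.lookup m j *
      (\<Prod>i\<in>Poly_Mapping.keys m - {j}. x i ^ Poly_Mapping.lookup m i)"
    by (simp add: mult.assoc)
qed simp

lemma mpoly_partial_eq_sum:
  "mpoly_partial f j x =
     (\<Sum>m \<in> Poly_Mapping.keys f. Poly_Mapping.lookup f m *
        (of_nat (Poly_Mapping.lookup m j) * x j ^ (Poly_Mapping.lookup m j - 1)) *
        (\<Prod>i \<in> Poly_Mapping.keys m - {j}. x i ^ Poly_Mapping.lookup m i))"
  unfolding mpoly_partial_def mpoly_eval_fun_upd
  by (rule DERIV_imp_deriv) (auto intro!: derivative_eq_intros sum.cong)

text \<open>
  The monomials \<open>x\<^sub>j x\<^sup>u\<close> of \<open>f\<close> with \<open>x\<^sup>u\<close> supported on \<open>I\<close>; for \<open>j \<notin> I\<close> they are the only ones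
  that contribute to \<open>\<partial>\<^sub>j f\<close> on the coordinate subspace of \<open>I\<close>.
\<close>

definition tangent_keys :: "mpoly_complex \<Rightarrow> nat set \<Rightarrow> nat \<Rightarrow> (nat \<Rightarrow>\<^sub>0 nat) set" where
  "tangent_keys f I j =
     {m \<in> Poly_Mapping.keys f. Poly_Mapping.lookup m j = 1 \<and> Poly_Mapping.keys m \<subseteq> insert j I}"

lemma finite_tangent_keys: "finite (tangent_keys f I j)"
  by (simp add: tangent_keys_def)

lemma prod_eq_0_outside_support:
  assumes "\<And>i. i \<notin> I \<Longrightarrow> x i = (0::complex)" "\<not> Poly_Mapping.keys m \<subseteq> insert j I"
  shows "(\<Prod>i \<in> Poly_Mapping.keys m - {j}. x i ^ Poly_Mapping.lookup m i) = 0"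
proof -
  obtain k where "k \<in> Poly_Mapping.keys m" "k \<noteq> j" "k \<notin> I"
    using assms(2) by auto
  then show ?thesis
    using assms(1)[of k] by (auto simp: in_keys_iff intro!: prod_zero bexI[of _ k])
qed

text \<open>Here \<open>x j = 0\<close>: exponent 0 of this variable dies by the factor
  \<open>of_nat 0\<close>, exponents above 1 by the remaining power of \<open>x j\<close>, and only
  exponent 1 survives.\<close>

lemma mpoly_partial_transversal:
  assumes supp: "\<And>i. i \<notin> I \<Longrightarrow> x i = 0" and "finite I" "j \<notin> I"
  shows "mpoly_partial f j x =
    (\<Sum>m \<in> tangent_keys f I j. Poly_Mapping.lookup f m * (\<Prod>i\<in>I. x i ^ Poly_Mapping.lookup m i))"
proof -
  have "mpoly_partial f j x = (\<Sum>m \<in> tangent_keys f I j. Poly_Mapping.lookup f m *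
        (of_nat (Poly_Mapping.lookup m j) * x j ^ (Poly_Mapping.lookup m j - 1)) *
        (\<Prod>i \<in> Poly_Mapping.keys m - {j}. x i ^ Poly_Mapping.lookup m i))"
    unfolding mpoly_partial_eq_sum
  proof (rule sum.mono_neutral_right)
    show "\<forall>m\<in>Poly_Mapping.keys f - tangent_keys f I j. Poly_Mapping.lookup f m *
        (of_nat (Poly_Mapping.lookup m j) * x j ^ (Poly_Mapping.lookup m j - 1)) *
        (\<Prod>i\<in>Poly_Mapping.keys m - {j}. x i ^ Poly_Mapping.lookup m i) = 0"
    proof
      fix m assume m: "m \<in> Poly_Mapping.keys f - tangent_keys f I j"
      show "Poly_Mapping.lookup f m *
        (of_nat (Poly_Mapping.lookup m j) * x j ^ (Poly_Mapping.lookup m j - 1)) *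
        (\<Prod>i\<in>Poly_Mapping.keys m - {j}. x i ^ Poly_Mapping.lookup m i) = 0"
      proof (cases "Poly_Mapping.keys m \<subseteq> insert j I")
        case True
        then have "Poly_Mapping.lookup m j \<noteq> 1"
          using m by (auto simp: tangent_keys_def)
        then show ?thesis
          using supp[OF \<open>j \<notin> I\<close>] by (cases "Poly_Mapping.lookup m j") auto
      next
        case False
        with prod_eq_0_outside_support[OF supp False] show ?thesis by simp
      qed
    qed
  qed (auto simp: tangent_keys_def)
  also have "\<dots> = (\<Sum>m \<in> tangent_keys f I j.
      Poly_Mapping.lookup f m * (\<Prod>i\<in>I. x i ^ Poly_Mapping.lookup m i))"
  proof (rule sum.cong)
    fix m assume m: "m \<in> tangent_keys f I j"
    have "(\<Prod>i \<in> Poly_Mapping.keys m - {j}. x i ^ Poly_Mapping.lookup m i) =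
        (\<Prod>i\<in>I. x i ^ Poly_Mapping.lookup m i)"
      using m \<open>j \<notin> I\<close> \<open>finite I\<close>
      by (intro prod.mono_neutral_left) (auto simp: tangent_keys_def in_keys_iff intro!: gr0I)
    with m show "Poly_Mapping.lookup f m *
        (of_nat (Poly_Mapping.lookup m j) * x j ^ (Poly_Mapping.lookup m j - 1)) *
        (\<Prod>i \<in> Poly_Mapping.keys m - {j}. x i ^ Poly_Mapping.lookup m i) =
        Poly_Mapping.lookup f m * (\<Prod>i\<in>I. x i ^ Poly_Mapping.lookup m i)"
      by (simp add: tangent_keys_def)
  qed simp
  finally show ?thesis .
qed

text \<open>Without a monomial supported on \<open>I\<close>, both \<open>f\<close> and its
  derivatives along \<open>I\<close> vanish on this subspace, so smoothness must come from a
  transversal direction.\<close>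

lemma quasi_smooth_transversal:
  assumes "quasi_smooth n f" "I \<subseteq> {..n}"
    and none: "\<And>m. m \<in> Poly_Mapping.keys f \<Longrightarrow> \<not> Poly_Mapping.keys m \<subseteq> I"
    and supp: "\<And>i. i \<notin> I \<Longrightarrow> x i = 0" and "p \<in> I" "x p \<noteq> 0"
  shows "\<exists>j\<le>n. j \<notin> I \<and>
    (\<Sum>m \<in> tangent_keys f I j. Poly_Mapping.lookup f m * (\<Prod>i\<in>I. x i ^ Poly_Mapping.lookup m i)) \<noteq> 0"
proof -
  have vanish: "(\<Prod>i \<in> Poly_Mapping.keys m - {j}. x i ^ Poly_Mapping.lookup m i) = 0"
    if "m \<in> Poly_Mapping.keys f" "j \<in> I" for m j
    using that none[of m] by (intro prod_eq_0_outside_support[OF supp]) (auto simp: insert_absorb)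
  \<comment> \<open>The trivial update gives access to \<open>mpoly_eval_fun_upd\<close>, where
    \<open>vanish\<close> applies.\<close>
  have "mpoly_eval f x = mpoly_eval f (x(p := x p))" by simp
  also have "\<dots> = 0"
    unfolding mpoly_eval_fun_upd using vanish \<open>p \<in> I\<close> by (intro sum.neutral) auto
  finally have "mpoly_eval f x = 0" .
  moreover have "\<exists>i\<le>n. x i \<noteq> 0"
    using assms by auto
  ultimately obtain j where j: "j \<le> n" "mpoly_partial f j x \<noteq> 0"
    using assms(1) by (auto simp: quasi_smooth_def)
  have "j \<notin> I"
  proof
    assume "j \<in> I"
    then have "mpoly_partial f j x = 0"
      unfolding mpoly_partial_eq_sum using vanish by (intro sum.neutral) auto
    with j show False by simp
  qed
  moreover have "finite I"
    using assms(2) finite_subset by blast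
  ultimately show ?thesis
    using j mpoly_partial_transversal[of I x j f, OF supp] by auto
qed

lemma quasi_smooth_single_keys:
  assumes "quasi_smooth n f" "p \<le> n"
  shows "(\<exists>m\<in>Poly_Mapping.keys f. Poly_Mapping.keys m \<subseteq> {p}) \<or>
    (\<exists>j\<le>n. j \<noteq> p \<and> tangent_keys f {p} j \<noteq> {})"
proof (rule disjCI)
  assume *: "\<not> (\<exists>j\<le>n. j \<noteq> p \<and> tangent_keys f {p} j \<noteq> {})"
  show "\<exists>m\<in>Poly_Mapping.keys f. Poly_Mapping.keys m \<subseteq> {p}"
    using quasi_smooth_transversal[OF assms(1), of "{p}" "\<lambda>i. if i = p then 1 else 0" p] * assms(2)
    by fastforce
qed

section \<open>From monomials to numerical conditions on the weights\<close>

lemma weighted_homogeneous_sum: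
  assumes "weighted_homogeneous n a d f" "m \<in> Poly_Mapping.keys f"
    and "Poly_Mapping.keys m \<subseteq> J" "J \<subseteq> {..n}"
  shows "(\<Sum>i\<in>J. a i * Poly_Mapping.lookup m i) = d"
proof -
  have "(\<Sum>i\<in>J. a i * Poly_Mapping.lookup m i) = (\<Sum>i\<le>n. a i * Poly_Mapping.lookup m i)"
    using assms(3,4) by (intro sum.mono_neutral_left) (auto simp: in_keys_iff subset_iff)
  with assms(1,2) show ?thesis
    by (simp add: weighted_homogeneous_def)
qed

lemma weighted_homogeneous_sum_tangent:
  assumes "weighted_homogeneous n a d f" "m \<in> tangent_keys f I j"
    and "I \<subseteq> {..n}" "j \<le> n" "j \<notin> I"
  shows "a j + (\<Sum>i\<in>I. a i * Poly_Mapping.lookup m i) = d"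
proof -
  have "(\<Sum>i\<in>insert j I. a i * Poly_Mapping.lookup m i) = d"
    using assms by (intro weighted_homogeneous_sum[where f = f and n = n]) (auto simp: tangent_keys_def)
  moreover have "finite I"
    using assms(3) finite_subset by blast
  ultimately show ?thesis
    using assms by (simp add: tangent_keys_def)
qed

text \<open>If only one transversal derivative \<open>G j\<close> could be nonzero on the plane, it
  would be a weighted form in two variables, of positive degree, without zeros off the
  origin.\<close>

lemma weighted_hypersurface_pair_keys:
  assumes X: "weighted_hypersurface n a d f" and pq: "p \<le> n" "q \<le> n" "p \<noteq> q"
  shows "(\<exists>m\<in>Poly_Mapping.keys f. Poly_Mapping.keys m \<subseteq> {p, q}) \<or>
    (\<exists>j j'. j \<le> n \<and> j' \<le> n \<and> j \<noteq> j' \<and> {j, j'} \<inter> {p, q} = {} \<and>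
       tangent_keys f {p, q} j \<noteq> {} \<and> tangent_keys f {p, q} j' \<noteq> {})"
proof (rule disjCI, rule ccontr)
  assume *: "\<not> (\<exists>j j'. j \<le> n \<and> j' \<le> n \<and> j \<noteq> j' \<and> {j, j'} \<inter> {p, q} = {} \<and>
       tangent_keys f {p, q} j \<noteq> {} \<and> tangent_keys f {p, q} j' \<noteq> {})"
    and none: "\<not> (\<exists>m\<in>Poly_Mapping.keys f. Poly_Mapping.keys m \<subseteq> {p, q})"
  have qs: "quasi_smooth n f" and wh: "weighted_homogeneous n a d f"
    and cone: "\<not> linear_cone n a d" and pos: "a p > 0"
    using X pq by (auto simp: weighted_hypersurface_def)
  define G where "G j x y = (\<Sum>m \<in> tangent_keys f {p, q} j. Poly_Mapping.lookup f m *
    (x ^ Poly_Mapping.lookup m p * y ^ Poly_Mapping.lookup m q))" for j and x y :: complex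
  have ex: "\<exists>j\<le>n. j \<notin> {p, q} \<and> G j x y \<noteq> 0" if "x \<noteq> 0 \<or> y \<noteq> 0" for x y
    using quasi_smooth_transversal[OF qs, of "{p, q}" "(\<lambda>i. 0)(p := x, q := y)" p]
      quasi_smooth_transversal[OF qs, of "{p, q}" "(\<lambda>i. 0)(p := x, q := y)" q]
      none that pq unfolding G_def by auto
  have nonempty: "tangent_keys f {p, q} j \<noteq> {}" if "G j x y \<noteq> 0" for j x y
    using that by (auto simp: G_def)
  obtain j where j: "j \<le> n" "j \<notin> {p, q}" "G j 1 0 \<noteq> 0"
    using ex[of 1 0] by auto
  have nz: "G j x y \<noteq> 0" if "x \<noteq> 0 \<or> y \<noteq> 0" for x y
    using ex[OF that] nonempty * j by blast
  have weight: "a j + (a p * Poly_Mapping.lookup m p + a q * Poly_Mapping.lookup m q) = d"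
    if "m \<in> tangent_keys f {p, q} j" for m
    using weighted_homogeneous_sum_tangent[OF wh that] j pq by simp
  \<comment> \<open>The weight equation recovers the exponent at \<open>p\<close> from that at
    \<open>q\<close>, so distinct monomials do not merge in \<open>P\<close>.\<close>
  have inj: "m = m'" if m: "m \<in> tangent_keys f {p, q} j" "m' \<in> tangent_keys f {p, q} j"
    and q: "Poly_Mapping.lookup m q = Poly_Mapping.lookup m' q" for m m'
  proof (rule poly_mapping_eqI)
    fix k
    have "a p * Poly_Mapping.lookup m p = a p * Poly_Mapping.lookup m' p"
      using weight[OF m(1)] weight[OF m(2)] unfolding q by linarith
    then have "Poly_Mapping.lookup m p = Poly_Mapping.lookup m' p"
      using pos by simp
    moreover have "Poly_Mapping.lookup m k = Poly_Mapping.lookup m' k" if "k \<notin> {p, q, j}"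
    proof -
      have "k \<notin> Poly_Mapping.keys m" "k \<notin> Poly_Mapping.keys m'"
        using m that by (auto simp: tangent_keys_def)
      then show ?thesis by (simp add: in_keys_iff)
    qed
    ultimately show "Poly_Mapping.lookup m k = Poly_Mapping.lookup m' k"
      using m q by (cases "k \<in> {p, q, j}") (auto simp: tangent_keys_def)
  qed
  define P where "P =
    (\<Sum>m \<in> tangent_keys f {p, q} j. monom (Poly_Mapping.lookup f m) (Poly_Mapping.lookup m q))"
  have P: "poly P t = G j 1 t" for t
    by (simp add: P_def G_def poly_sum poly_monom)
  have "constant (poly P)"
    using fundamental_theorem_of_algebra[of P] nz P by auto
  then have deg: "degree P = 0"
    by (simp add: constant_degree)
  have "Poly_Mapping.lookup m q = 0" if m: "m \<in> tangent_keys f {p, q} j" for m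
  proof (rule ccontr)
    assume "Poly_Mapping.lookup m q \<noteq> 0"
    then have "0 = coeff P (Poly_Mapping.lookup m q)"
      using deg by (simp add: coeff_eq_0)
    also have "\<dots> = (\<Sum>m' \<in> tangent_keys f {p, q} j. if m' = m then Poly_Mapping.lookup f m else 0)"
      unfolding P_def coeff_sum coeff_monom using inj[OF _ m] by (intro sum.cong) auto
    also have "\<dots> = Poly_Mapping.lookup f m"
      using m by (simp add: finite_tangent_keys)
    finally show False
      using m by (auto simp: tangent_keys_def in_keys_iff)
  qed
  \<comment> \<open>If both exponents vanished, the monomial would be a single variable and
    \<open>d = a j\<close>.\<close>
  then have "Poly_Mapping.lookup m p \<noteq> 0" if "m \<in> tangent_keys f {p, q} j" for m
    using weight[OF that] that cone j(1) by (auto simp: linear_cone_def)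
  then have "G j 0 1 = 0"
    unfolding G_def by (intro sum.neutral) auto
  then show False
    using nz[of 0 1] by simp
qed

lemma weighted_hypersurface_single:
  assumes X: "weighted_hypersurface n a d f" and p: "p \<le> n"
  shows "(\<exists>k. d = k * a p) \<or> (\<exists>j k. j \<le> n \<and> j \<noteq> p \<and> d = a j + k * a p)"
proof -
  have wh: "weighted_homogeneous n a d f" and qs: "quasi_smooth n f"
    using X by (auto simp: weighted_hypersurface_def)
  from quasi_smooth_single_keys[OF qs p] show ?thesis
  proof (elim disjE bexE exE conjE)
    fix m assume "m \<in> Poly_Mapping.keys f" "Poly_Mapping.keys m \<subseteq> {p}"
    then have "a p * Poly_Mapping.lookup m p = d"
      using weighted_homogeneous_sum[OF wh, of m "{p}"] p by simp
    then show ?thesis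
      by (metis mult.commute)
  next
    fix j assume j: "j \<le> n" "j \<noteq> p" "tangent_keys f {p} j \<noteq> {}"
    then obtain m where "m \<in> tangent_keys f {p} j" by auto
    then have "a j + a p * Poly_Mapping.lookup m p = d"
      using weighted_homogeneous_sum_tangent[OF wh, of m "{p}" j] j p by simp
    then show ?thesis
      using j by (metis mult.commute)
  qed
qed

lemma weighted_hypersurface_pair:
  assumes X: "weighted_hypersurface n a d f" and pq: "p \<le> n" "q \<le> n" "p \<noteq> q"
  shows "(\<exists>u v. d = u * a p + v * a q) \<or>
    (\<exists>j j'. j \<le> n \<and> j' \<le> n \<and> j \<noteq> j' \<and> {j, j'} \<inter> {p, q} = {} \<and>
       (\<exists>u v. d = a j + (u * a p + v * a q)) \<and> (\<exists>u v. d = a j' + (u * a p + v * a q)))"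
proof -
  have wh: "weighted_homogeneous n a d f"
    using X by (auto simp: weighted_hypersurface_def)
  have tangent: "\<exists>u v. d = a j + (u * a p + v * a q)"
    if j: "j \<le> n" "j \<notin> {p, q}" "tangent_keys f {p, q} j \<noteq> {}" for j
  proof -
    obtain m where "m \<in> tangent_keys f {p, q} j"
      using j by auto
    then have "a j + (a p * Poly_Mapping.lookup m p + a q * Poly_Mapping.lookup m q) = d"
      using weighted_homogeneous_sum_tangent[OF wh, of m "{p, q}" j] j pq by simp
    then show ?thesis
      by (metis mult.commute)
  qed
  from weighted_hypersurface_pair_keys[OF X pq] show ?thesis
  proof (rule disj_forward)
    assume "\<exists>m\<in>Poly_Mapping.keys f. Poly_Mapping.keys m \<subseteq> {p, q}"
    then obtain m where "m \<in> Poly_Mapping.keys f" "Poly_Mapping.keys m \<subseteq> {p, q}" by auto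
    then have "a p * Poly_Mapping.lookup m p + a q * Poly_Mapping.lookup m q = d"
      using weighted_homogeneous_sum[OF wh, of m "{p, q}"] pq by simp
    then show "\<exists>u v. d = u * a p + v * a q"
      by (metis mult.commute)
  next
    assume "\<exists>j j'. j \<le> n \<and> j' \<le> n \<and> j \<noteq> j' \<and> {j, j'} \<inter> {p, q} = {} \<and>
       tangent_keys f {p, q} j \<noteq> {} \<and> tangent_keys f {p, q} j' \<noteq> {}"
    then obtain j j' where "j \<le> n" "j' \<le> n" "j \<noteq> j'" "{j, j'} \<inter> {p, q} = {}"
       "tangent_keys f {p, q} j \<noteq> {}" "tangent_keys f {p, q} j' \<noteq> {}" by blast
    with tangent[of j] tangent[of j']
    show "\<exists>j j'. j \<le> n \<and> j' \<le> n \<and> j \<noteq> j' \<and> {j, j'} \<inter> {p, q} = {} \<and>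
       (\<exists>u v. d = a j + (u * a p + v * a q)) \<and> (\<exists>u v. d = a j' + (u * a p + v * a q))"
      by (intro exI[of _ j] exI[of _ j']) simp
  qed
qed

section \<open>The weights of a hypothetical counterexample\<close>

lemma multiple_cases:
  fixes w z :: nat
  assumes "z = k * w" "z < 4 * w"
  shows "z = 0 \<or> z = w \<or> z = 2 * w \<or> z = 3 * w"
proof -
  have "k < 4" using assms by simp
  then have "k = 0 \<or> k = 1 \<or> k = 2 \<or> k = 3" by auto
  with assms(1) show ?thesis by auto
qed

lemma combination_cases:
  fixes v w z :: nat
  assumes "z = k * v + l * w" "v \<le> w" "z < 4 * v"
  shows "z \<in> {0, v, w, 2 * v, v + w, 2 * w, 3 * v, 2 * v + w, v + 2 * w, 3 * w}"
proof -
  have "k * v + l * v \<le> z" using assms by (simp add: mult_le_mono)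
  then have "(k + l) * v < 4 * v" using assms(3) by (simp add: algebra_simps)
  then have "k + l < 4" by simp
  then have "k = 0 \<or> k = 1 \<or> k = 2 \<or> k = 3" "l = 0 \<or> l = 1 \<or> l = 2 \<or> l = 3"
    by presburger+
  with \<open>k + l < 4\<close> show ?thesis
    unfolding assms(1) by (elim disjE) simp_all
qed

text \<open>The polynomial is gone: \<open>single\<close> and \<open>pair\<close> record what
  quasi-smoothness gives on axes and planes. \<open>gcd4\<close> allows any common divisor
  \<open>g\<close>, so it applies directly to \<open>2\<close> and to \<open>a 5\<close>.\<close>

locale FK3_counterexample =
  fixes a :: "nat \<Rightarrow> nat" and d :: nat
  assumes mono_a: "mono_on {..5} a"
    and sum_a: "(\<Sum>i\<le>5. a i) = 2 * d"
    and pos: "a 0 > 0"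
    and not_cone: "\<And>i. i \<le> 5 \<Longrightarrow> d \<noteq> a i"
    and single: "\<And>p. p \<le> 5 \<Longrightarrow>
      (\<exists>k. d = k * a p) \<or> (\<exists>j k. j \<le> 5 \<and> j \<noteq> p \<and> d = a j + k * a p)"
    and pair: "\<And>p q. p \<le> 5 \<Longrightarrow> q \<le> 5 \<Longrightarrow> p \<noteq> q \<Longrightarrow> (\<exists>u v. d = u * a p + v * a q) \<or>
      (\<exists>j j'. j \<le> 5 \<and> j' \<le> 5 \<and> j \<noteq> j' \<and> {j, j'} \<inter> {p, q} = {} \<and>
         (\<exists>u v. d = a j + (u * a p + v * a q)) \<and> (\<exists>u v. d = a j' + (u * a p + v * a q)))"
    and gcd4: "\<And>I g. I \<subseteq> {..5} \<Longrightarrow> card I = 4 \<Longrightarrow> (\<And>i. i \<in> I \<Longrightarrow> g dvd a i) \<Longrightarrow> g = 1"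
    and a5_gt: "a 5 > 1"
    and no_complement: "\<And>i. i \<le> 4 \<Longrightarrow> a i + a 5 \<noteq> d"
begin

section \<open>Order, sum and parity of the weights\<close>

lemma mono: "a 0 \<le> a 1" "a 1 \<le> a 2" "a 2 \<le> a 3" "a 3 \<le> a 4" "a 4 \<le> a 5"
  by (rule mono_onD[OF mono_a]; simp)+

lemma sum: "a 0 + a 1 + a 2 + a 3 + a 4 + a 5 = 2 * d"
  using sum_a by (simp add: numeral_eq_Suc atMost_Suc add_ac)

text \<open>Four even weights contradict \<open>gcd4\<close>. As the total is even, the odd weights
  are even in number, hence so are the even ones among six; this excludes three.\<close>

lemma card_even_le_2: "card {i \<in> {..5}. even (a i)} \<le> 2"
proof -
  let ?E = "{i \<in> {..5}. even (a i)}" and ?O = "{i \<in> {..5}. odd (a i)}"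
  have "\<not> 4 \<le> card ?E"
  proof
    assume "4 \<le> card ?E"
    then obtain I where "I \<subseteq> ?E" "card I = 4"
      by (meson obtain_subset_with_card_n)
    then show False
      using gcd4[of I 2] by auto
  qed
  moreover have "even (card ?O)"
    using sum_a even_sum_iff[of "{..5}" a] by simp
  moreover have "card ?E + card ?O = card (?E \<union> ?O)"
    by (rule card_Un_disjoint[symmetric]) auto
  moreover have "?E \<union> ?O = {..5}"
    by auto
  ultimately show ?thesis
    by simp presburger
qed

lemma not_three_even:
  assumes "i \<le> 5" "j \<le> 5" "k \<le> 5" "i \<noteq> j" "i \<noteq> k" "j \<noteq> k" "even (a i)" "even (a j)"
  shows "odd (a k)"
proof
  assume "even (a k)"
  then have "card {i, j, k} \<le> card {i \<in> {..5}. even (a i)}"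
    using assms by (intro card_mono) auto
  then show False
    using card_even_le_2 assms by simp
qed

lemma not_equal: "a 2 < a 5"
proof (rule ccontr)
  assume "\<not> a 2 < a 5"
  then have "a 2 = a 5" "a 3 = a 5" "a 4 = a 5"
    using mono by linarith+
  then have "a 5 = 1"
    by (intro gcd4[of "{2, 3, 4, 5}"]) auto
  then show False
    using a5_gt by simp
qed

section \<open>Determination of the degree\<close>

lemma degree_pos: "d > 0"
  using sum pos by linarith

lemma single_cases:
  assumes "p \<le> 5" "d < 4 * a p"
  shows "d = 2 * a p \<or> d = 3 * a p \<or>
    (\<exists>j\<in>{0, 1, 2, 3, 4, 5} - {p}. d = a j + a p \<or> d = a j + 2 * a p \<or> d = a j + 3 * a p)"
  using single[OF assms(1)]
proof (elim disjE exE conjE)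
  fix k assume "d = k * a p"
  from multiple_cases[OF this] assms not_cone[of p] degree_pos show ?thesis
    by linarith
next
  fix j k assume j: "j \<le> 5" "j \<noteq> p" "d = a j + k * a p"
  have "j \<in> {0, 1, 2, 3, 4, 5} - {p}" using j(1,2) by auto
  moreover have "k * a p = 0 \<or> k * a p = a p \<or> k * a p = 2 * a p \<or> k * a p = 3 * a p"
    using multiple_cases[OF refl, of k "a p"] assms j by linarith
  ultimately show ?thesis
    using j(3) not_cone[OF j(1)] by auto
qed

text \<open>The value \<open>3 * a 5\<close> would make all weights equal. For \<open>j\<close>
  other than 0, \<open>2 * d \<le> a 0 + a j + 4 * a 5\<close>, so \<open>d = a j + 2 * a 5\<close>
  forces \<open>a j = a 0\<close>.\<close>

lemma degree_cases: "d = 2 * a 5 \<or> d = 2 * a 5 + a 0"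
proof -
  have "d < 4 * a 5" using sum mono pos by linarith
  then have "d = 2 * a 5 \<or> d = 3 * a 5 \<or>
    (\<exists>j\<in>{0, 1, 2, 3, 4}. d = a j + a 5 \<or> d = a j + 2 * a 5 \<or> d = a j + 3 * a 5)"
    using single_cases[of 5] by (simp add: insert_Diff_if)
  moreover have "d \<noteq> 3 * a 5"
    using sum mono not_equal by linarith
  moreover have "d \<noteq> a j + a 5" "d \<noteq> a j + 3 * a 5" "d = a j + 2 * a 5 \<Longrightarrow> a j = a 0"
    if "j \<in> {0, 1, 2, 3, 4}" for j
  proof -
    show "d \<noteq> a j + a 5" using that no_complement[of j] by auto
    show "d \<noteq> a j + 3 * a 5" using that sum mono pos by auto
    show "a j = a 0" if "d = a j + 2 * a 5"
      using that \<open>j \<in> _\<close> sum mono by auto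
  qed
  ultimately show ?thesis by (metis add.commute)
qed

lemma degree_ne: "d \<noteq> 2 * a 5 + a 0"
proof
  assume d: "d = 2 * a 5 + a 0"
  have small: "d < 4 * a 4" using d sum mono not_equal by linarith
  \<comment> \<open>At least two factors from the plane are required, since \<open>a j\<close> with
    one such factor gives at most \<open>2 * a 5 < d\<close>.\<close>
  have tangent: "a j + 2 * a 4 \<le> a 0 + 2 * a 5"
    if j: "j \<in> {0, 1, 2, 3}" "d = a j + (u * a 4 + v * a 5)" for j u v
  proof -
    have "a 0 \<le> a j" "a j \<le> a 4" "u * a 4 + v * a 5 < 4 * a 4"
      using j mono small by auto
    with combination_cases[OF refl mono(5) this(3)] j(2) small d sum mono pos not_equal
    show ?thesis by (elim insertE emptyE; linarith)
  qed
  have "(4::nat) \<le> 5" "(5::nat) \<le> 5" "(4::nat) \<noteq> 5" by simp_all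
  from pair[OF this] show False
  proof (elim disjE exE conjE)
    fix u v assume "d = u * a 4 + v * a 5"
    from combination_cases[OF this mono(5) small] small d sum mono pos not_equal show False
      by (elim insertE emptyE; linarith)
  next
    fix j j' u v u' v'
    assume j: "j \<le> 5" "j' \<le> 5" "{j, j'} \<inter> {4, 5} = {}" "j \<noteq> j'"
      "d = a j + (u * a 4 + v * a 5)" "d = a j' + (u' * a 4 + v' * a 5)"
    have *: "j \<in> {0, 1, 2, 3}" "j' \<in> {0, 1, 2, 3}"
      using j(1-3) by auto
    \<comment> \<open>One of two distinct indices is not 0. Then
      \<open>a 1 + 2 * a 4 \<le> d\<close>, and the sum yields
      \<open>a 4 + a 5 \<le> a 2 + a 3\<close>, so \<open>a 2 = a 5\<close>.\<close>
    then have "a 1 \<le> a j \<or> a 1 \<le> a j'"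
      using \<open>j \<noteq> j'\<close> mono by auto
    with tangent[OF *(1) j(5)] tangent[OF *(2) j(6)] d sum mono not_equal show False
      by linarith
  qed
qed

lemma degree_eq: "d = 2 * a 5"
  using degree_cases degree_ne by blast

section \<open>Axis and plane conditions in degree \<open>2 * a 5\<close>\<close>

lemma a4_less: "a 4 < a 5"
  using no_complement[of 4] degree_eq mono by auto

lemma single_4:
  "d = 3 * a 4 \<or> d = a 3 + 2 * a 4 \<or> d = a 0 + 2 * a 4 \<or> d = a 1 + 2 * a 4 \<or> d = a 2 + 2 * a 4"
proof -
  have "d < 4 * a 4" using degree_eq sum mono pos by linarith
  then have "d = 2 * a 4 \<or> d = 3 * a 4 \<or>
    (\<exists>j\<in>{0, 1, 2, 3, 5}. d = a j + a 4 \<or> d = a j + 2 * a 4 \<or> d = a j + 3 * a 4)"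
    using single_cases[of 4] by (simp add: insert_Diff_if)
  moreover have "d \<noteq> 2 * a 4" "d \<noteq> a 5 + a 4" "d \<noteq> a 5 + 2 * a 4" "d \<noteq> a 5 + 3 * a 4"
    using degree_eq sum mono a4_less pos by linarith+
  moreover have "d \<noteq> a j + a 4" "d \<noteq> a j + 3 * a 4" if "j \<in> {0, 1, 2, 3}" for j
    using that degree_eq sum mono a4_less pos by auto
  ultimately show ?thesis
    by blast
qed

lemma single_3:
  "d = 3 * a 3 \<or> d = a 4 + 2 * a 3 \<or> d = a 0 + 2 * a 3 \<or> d = a 1 + 2 * a 3 \<or> d = a 2 + 2 * a 3"
proof -
  \<comment> \<open>As \<open>a 4 < a 5\<close>, the four smallest weights sum to more than
    \<open>2 * a 5\<close>.\<close>
  have "d < 4 * a 3" using degree_eq sum mono a4_less by linarith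
  then have "d = 2 * a 3 \<or> d = 3 * a 3 \<or>
    (\<exists>j\<in>{0, 1, 2, 4, 5}. d = a j + a 3 \<or> d = a j + 2 * a 3 \<or> d = a j + 3 * a 3)"
    using single_cases[of 3] by (simp add: insert_Diff_if)
  then show ?thesis
    using degree_eq sum mono a4_less pos
    by (elim disjE bexE insertE emptyE; hypsubst; (linarith | blast))
qed

text \<open>The hypothesis makes \<open>a 0 + a 1 + 2 * a 2\<close> exceed \<open>d\<close>, which
  bounds the coefficient of \<open>a 2\<close>. The case \<open>d \<le> 3 * a 2\<close> gathers pure
  powers and the tangent indices 0 and 1.\<close>

lemma single_2:
  assumes "a 3 + a 4 < a 2 + a 5"
  shows "d \<le> 3 * a 2 \<or> d = a 3 + 2 * a 2 \<or> d = a 4 + 2 * a 2"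
proof -
  have "d < 4 * a 2"
    using assms degree_eq sum mono by linarith
  then have "d = 2 * a 2 \<or> d = 3 * a 2 \<or>
    (\<exists>j\<in>{0, 1, 3, 4, 5}. d = a j + a 2 \<or> d = a j + 2 * a 2 \<or> d = a j + 3 * a 2)"
    using single_cases[of 2] by (simp add: insert_Diff_if)
  then show ?thesis
    using assms degree_eq sum mono a4_less pos
    by (elim disjE bexE insertE emptyE; hypsubst; (linarith | (rule disjI1, linarith) | blast))
qed

text \<open>Otherwise the axes of indices 4, 3 and 2 force \<open>a 2 = a 3 = a 4\<close>, and
  \<open>3 * a 4 = 2 * a 5\<close> makes these three weights even.\<close>

lemma a4_gt: "d < 3 * a 4"
proof (rule ccontr)
  assume "\<not> d < 3 * a 4"
  then have "d \<ge> 3 * a 4" by simp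
  have eq: "d = 3 * a 4"
    using single_4 \<open>d \<ge> 3 * a 4\<close> mono by (elim disjE; linarith)
  have "a 3 = a 4"
    using single_3 \<open>d \<ge> 3 * a 4\<close> mono eq by (elim disjE; linarith)
  note eq = eq this
  then have "a 3 + a 4 < a 2 + a 5" using degree_eq sum mono pos by linarith
  from single_2[OF this] have "a 2 = a 3"
    using eq mono by (elim disjE; linarith)
  have "even (a 4)"
    using eq(1) degree_eq by presburger
  then show False
    using not_three_even[of 2 3 4] eq \<open>a 2 = a 3\<close> by simp
qed

lemma tangent_4: "\<exists>i\<in>{0, 1, 2}. d = a i + 2 * a 4"
proof -
  \<comment> \<open>Equality would, by \<open>single_3\<close>, force \<open>a 3 = a 4\<close> and
    so \<open>d = 3 * a 4\<close>.\<close>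
  have "d \<noteq> a 3 + 2 * a 4"
    using single_3 a4_gt mono by (elim disjE; linarith)
  then show ?thesis
    using single_4 a4_gt by auto
qed

text \<open>Otherwise \<open>a 3\<close>, the tangent weight \<open>a i = 2 * (a 5 - a 4)\<close>
  and one of \<open>a 2\<close>, \<open>a 4\<close> would be three even weights.\<close>

lemma degree_ne_3_a3: "d \<noteq> 3 * a 3"
proof
  assume d: "d = 3 * a 3"
  obtain i where i: "i \<in> {0, 1, 2}" "d = a i + 2 * a 4"
    using tangent_4 by blast
  have "a 3 + a 4 < a 2 + a 5"
    using i d degree_eq sum mono a4_gt a4_less by auto
  from single_2[OF this] have a2: "a 2 = a 3 \<or> d = a 4 + 2 * a 2"
    using d mono by auto
  have "i \<in> {0, 1}"
    using i a2 d a4_gt by auto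
  have "even (a i)" "even (a 3)"
    using i(2) d degree_eq by presburger+
  moreover have "even (a 2) \<or> even (a 4)"
    using a2 \<open>even (a 3)\<close> degree_eq by presburger
  ultimately show False
    using not_three_even[of i 3 2] not_three_even[of i 3 4] \<open>i \<in> {0, 1}\<close> by auto
qed

text \<open>Equality gives \<open>a 2 = a 3\<close>, so on the plane of indices 2 and 3 all
  combinations are multiples of \<open>a 2\<close>. Then 4 is the only possible tangent index, while
  two are required.\<close>

lemma degree_ne_a4_2_a3: "d \<noteq> a 4 + 2 * a 3"
proof
  assume d: "d = a 4 + 2 * a 3"
  obtain i where i: "i \<in> {0, 1, 2}" "d = a i + 2 * a 4"
    using tangent_4 by blast
  have "a 3 + a 4 < a 2 + a 5"
    using i d degree_eq sum mono a4_gt by auto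
  from single_2[OF this] have a2: "a 2 = a 3"
    using d a4_gt mono by (elim disjE; linarith)
  then have small: "d < 4 * a 2"
    using d mono degree_eq sum a4_less by linarith
  have i01: "d = a 0 + 2 * a 4 \<or> d = a 1 + 2 * a 4"
    using i a2 d a4_gt by auto
  have between: "a 0 + 2 * a 2 < d" "d < a 0 + 3 * a 2" "a 1 + 2 * a 2 < d" "d < a 1 + 3 * a 2"
    using i01 d a2 degree_eq sum mono a4_gt a4_less by (elim disjE; linarith)+
  have between_5: "a 5 + a 2 < d" "d < a 5 + 2 * a 2"
    using d a2 degree_eq mono a4_less by linarith+
  have forced: "j = 4" if j: "j \<in> {0, 1, 4, 5}" "d = a j + (u * a 2 + v * a 3)" for j u v
  proof -
    have "u * a 2 + v * a 3 = (u + v) * a 2"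
      using a2 by (simp add: algebra_simps)
    moreover from this have "(u + v) * a 2 < 4 * a 2"
      using j(2) small by linarith
    ultimately have "d = a j \<or> d = a j + a 2 \<or> d = a j + 2 * a 2 \<or> d = a j + 3 * a 2"
      using multiple_cases[OF refl, of "u + v" "a 2"] j(2) by linarith
    then have "j \<notin> {0, 1, 5}"
      using between between_5 by (intro notI, elim insertE emptyE; simp; linarith)
    with j(1) show ?thesis by blast
  qed
  have "(2::nat) \<le> 5" "(3::nat) \<le> 5" "(2::nat) \<noteq> 3" by simp_all
  from pair[OF this] show False
  proof (elim disjE exE conjE)
    fix u v assume uv: "d = u * a 2 + v * a 3"
    then have "d = (u + v) * a 2"
      using a2 by (simp add: algebra_simps)
    from multiple_cases[OF this small] a2 d a4_gt a4_less degree_eq degree_pos show False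
      by linarith
  next
    fix j j' u v u' v'
    assume j: "j \<le> 5" "j' \<le> 5" "{j, j'} \<inter> {2, 3} = {}" "j \<noteq> j'"
      "d = a j + (u * a 2 + v * a 3)" "d = a j' + (u' * a 2 + v' * a 3)"
    have "j \<in> {0, 1, 4, 5}" "j' \<in> {0, 1, 4, 5}"
      using j(1-3) by auto
    with forced[OF _ j(5)] forced[OF _ j(6)] j(4) show False by simp
  qed
qed

text \<open>If \<open>a 3 = a 4\<close>, the two axis conditions might use the same index; the plane
  of indices 3 and 4 supplies two distinct ones.\<close>

lemma tangent_pair: "\<exists>i\<in>{0, 1, 2}. \<exists>j\<in>{0, 1, 2}. i \<noteq> j \<and> d = a i + 2 * a 4 \<and> d = a j + 2 * a 3"
proof (cases "a 3 = a 4")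
  case False
  then show ?thesis
    using tangent_4 single_3 degree_ne_3_a3 degree_ne_a4_2_a3 by fastforce
next
  case True
  have small: "d < 4 * a 3"
    using True a4_gt pos mono by linarith
  have tangent: "j \<in> {0, 1, 2} \<and> d = a j + 2 * a 3"
    if j: "j \<in> {0, 1, 2, 5}" "d = a j + (u * a 3 + v * a 4)" for j u v
  proof -
    have "u * a 3 + v * a 4 = (u + v) * a 3"
      using True by (simp add: algebra_simps)
    moreover from this have "(u + v) * a 3 < 4 * a 3"
      using j(2) small by linarith
    ultimately have "d = a j \<or> d = a j + a 3 \<or> d = a j + 2 * a 3 \<or> d = a j + 3 * a 3"
      using multiple_cases[OF refl, of "u + v" "a 3"] j(2) by linarith
    with j(1) True degree_eq sum mono a4_gt a4_less pos show ?thesis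
      by (elim disjE insertE emptyE; hypsubst; (linarith | blast))
  qed
  have "(3::nat) \<le> 5" "(4::nat) \<le> 5" "(3::nat) \<noteq> 4" by simp_all
  from pair[OF this] show ?thesis
  proof (elim disjE exE conjE)
    fix u v assume "d = u * a 3 + v * a 4"
    then have "d = (u + v) * a 3"
      using True by (simp add: algebra_simps)
    from multiple_cases[OF this small] True a4_gt a4_less degree_eq degree_pos show ?thesis
      by linarith
  next
    fix j j' u v u' v'
    assume j: "j \<le> 5" "j' \<le> 5" "{j, j'} \<inter> {3, 4} = {}" "j \<noteq> j'"
      "d = a j + (u * a 3 + v * a 4)" "d = a j' + (u' * a 3 + v' * a 4)"
    have "j \<in> {0, 1, 2, 5}" "j' \<in> {0, 1, 2, 5}"
      using j(1-3) by auto
    with tangent[OF _ j(5)] tangent[OF _ j(6)] j(4) True show ?thesis by metis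
  qed
qed

section \<open>Contradiction modulo 4\<close>

lemma inconsistent: False
proof -
  obtain i j where i: "i \<in> {0, 1, 2}" "d = a i + 2 * a 4" and j: "j \<in> {0, 1, 2}" "d = a j + 2 * a 3"
    and "i \<noteq> j"
    using tangent_pair by blast
  have ev: "even (a i)" "even (a j)"
    using i(2) j(2) degree_eq by presburger+
  have odds: "odd (a k)" if "k \<le> 5" "k \<noteq> i" "k \<noteq> j" for k
    using not_three_even[of i j k] ev i(1) j(1) \<open>i \<noteq> j\<close> that by auto
  have odds345: "odd (a 3)" "odd (a 4)" "odd (a 5)"
    using odds i(1) j(1) by auto
  \<comment> \<open>Both weights are twice a difference of odd weights.\<close>
  have dvd4: "4 dvd a i" "4 dvd a j"
    using i(2) j(2) degree_eq odds345 by presburger+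
  have "\<not> 4 dvd d"
    using odds345 degree_eq by presburger
  have "i \<le> 5" using i(1) by auto
  from single[OF this] show False
  proof (elim disjE exE conjE)
    fix k assume "d = k * a i"
    with dvd4 \<open>\<not> 4 dvd d\<close> show False by simp
  next
    fix l k assume l: "l \<le> 5" "l \<noteq> i" "d = a l + k * a i"
    have "4 dvd k * a i" using dvd4 by simp
    \<comment> \<open>Either \<open>l = j\<close> or \<open>a l\<close> is odd; neither fits
      \<open>d\<close>, which is 2 modulo 4.\<close>
    moreover have "4 dvd a l \<or> odd (a l)"
      using odds[of l] l dvd4 by auto
    ultimately show False
      using l(3) \<open>\<not> 4 dvd d\<close> degree_eq by presburger
  qed
qed

end

theorem theorem2p8:
  fixes a :: "nat \<Rightarrow> nat" and d :: nat and f :: mpoly_complex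
  assumes "FK3_weighted_fourfold a d f"
    and "mono_on {..5} a"
    and "dim_sing_le_1 a d"
    and "a 5 > 1"
  shows "\<exists>i\<in>{0..4}. a i + a 5 = d"
proof (rule ccontr)
  assume no: "\<not> (\<exists>i\<in>{0..4}. a i + a 5 = d)"
  have X: "weighted_hypersurface 5 a d f" and sum: "(\<Sum>i\<le>5. a i) = 2 * d"
    using assms(1) by (auto simp: FK3_weighted_fourfold_def)
  interpret FK3_counterexample a d
  proof
    show "a 0 > 0" "\<And>i. i \<le> 5 \<Longrightarrow> d \<noteq> a i"
      using X by (auto simp: weighted_hypersurface_def linear_cone_def)
    show "\<And>i. i \<le> 4 \<Longrightarrow> a i + a 5 \<noteq> d"
      using no by auto
    fix I g assume I: "I \<subseteq> {..5}" "card I = 4" "\<And>i. i \<in> I \<Longrightarrow> g dvd a i"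
    have "g dvd Gcd (a ` I)"
      using I(3) by (intro Gcd_greatest) auto
    also have "Gcd (a ` I) = 1"
      using I(1,2) assms(3) by (simp add: dim_sing_le_1_def)
    finally show "g = 1" by simp
  qed (fact assms(2,4) sum weighted_hypersurface_single[OF X] weighted_hypersurface_pair[OF X])+
  show False by (rule inconsistent)
qed

end
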